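(* When $0<\mathcal P_{\rm err}^{\rm b,Th}<1$ and $0<\mathcal P_{\rm err}^{\rm e,Th}<1$, the security gap $\Delta S=10\log_{10}(\gamma_{\rm b}^{\inf}/\gamma_{\rm e}^{\sup})$ of the additive white Gaussian noise (AWGN) channel, defined in the context, with the Gaussian input distribution $\mathcal{CN}(0,1)$ used in both Bob's and Eve's bounds, is given by $$\Delta S=10\log_{10}\frac{(1+\breve\rho)\left(\left(\mathcal P_{\rm err}^{\rm b,Th}\right)^{-\frac1{n\breve\rho}}e^{R}-1\right)}{(1+\breve\rho')\left(\left(1-\mathcal P_{\rm err}^{\rm e,Th}\right)^{-\frac1{n\breve\rho'}}e^{R}-1\right)},$$ where $n$ is the blocklength, $R$ is the transmission rate, and $$\breve\rho=\arg\min_{0<\rho\le1}(1+\rho)\left(\left(\mathcal P_{\rm err}^{\rm b,Th}\right)^{-\frac1{n\rho}}e^{R}-1\right),\qquad \breve\rho'=\arg\max_{-1<\rho'<0}(1+\rho')\left(\left(1-\mathcal P_{\rm err}^{\rm e,Th}\right)^{-\frac1{n\rho'}}e^{R}-1\right).$$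
   Context: Bob and Eve receive $Y_{{\rm b},i}=X_i+\eta_{{\rm b},i}$ and $Y_{{\rm e},i}=X_i+\eta_{{\rm e},i}$, $i=1,\dots,n$, with circularly symmetric complex Gaussian noises $\eta_{{\rm b},i}\sim\mathcal{CN}(0,\sigma_{\rm b}^2)$, $\eta_{{\rm e},i}\sim\mathcal{CN}(0,\sigma_{\rm e}^2)$ and $\mathbb E|X_i|^2=1$; the SNRs are $\gamma_{\rm b}=1/\sigma_{\rm b}^2$ and $\gamma_{\rm e}=1/\sigma_{\rm e}^2$. The transmission rate $R$ is in nats per channel use. The capacity at SNR $\gamma$ is $C_{\rm AWGN}(\gamma)=\ln(1+\gamma)$, and $\gamma_0=C_{\rm AWGN}^{-1}(R)=e^R-1$. With input distribution $\mathcal{CN}(0,1)$ the Gallager functions are $$E_0^{\rm b}(\rho,\gamma_{\rm b})=\rho\ln\Big(1+\frac{\gamma_{\rm b}}{1+\rho}\Big)\ (0\le\rho\le1),\qquad E_0^{\rm e}(\rho',\gamma_{\rm e})=\rho'\ln\Big(1+\frac{\gamma_{\rm e}}{1+\rho'}\Big)\ (-1<\rho'\le0).$$ Let $\beta>0$ denote the bit error rate (BER) at the output of an error-amplifying substitution-permutation network when exactly one input bit is in error. Bob's BER upper bound and Eve's BER lower bound, optimized over $\rho$ and $\rho'$, are $$P_{\rm BER}^{\rm b,U}(R,\gamma_{\rm b})=\tfrac12\min_{0\le\rho\le1}\exp\big(-n\{E_0^{\rm b}(\rho,\gamma_{\rm b})-\rho R\}\big),$$ $$P_{\rm BER}^{\rm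 e,L}(R,\gamma_{\rm e})=\beta\max_{-1<\rho'\le0}\Big(1-\exp\big(-n\{E_0^{\rm e}(\rho',\gamma_{\rm e})-\rho'R\}\big)\Big).$$ $\mathcal P_{\rm err}^{\rm b,Th}$ and $\mathcal P_{\rm err}^{\rm e,Th}$ are block error probability thresholds, and the corresponding BER thresholds are $\mathcal P_{\rm BER}^{\rm b,Th}=\tfrac12\mathcal P_{\rm err}^{\rm b,Th}$ and $\mathcal P_{\rm BER}^{\rm e,Th}=\beta\,\mathcal P_{\rm err}^{\rm e,Th}$. Then $$\gamma_{\rm b}^{\inf}=\inf_{\gamma_{\rm b}>\gamma_0}\gamma_{\rm b}\ \text{ subject to } P_{\rm BER}^{\rm b,U}(R,\gamma_{\rm b})\le\mathcal P_{\rm BER}^{\rm b,Th},\qquad \gamma_{\rm e}^{\sup}=\sup_{0\le\gamma_{\rm e}<\gamma_0}\gamma_{\rm e}\ \text{ subject to } P_{\rm BER}^{\rm e,L}(R,\gamma_{\rm e})\ge\mathcal P_{\rm BER}^{\rm e,Th},$$ and the security gap is $\Delta S=10\log_{10}(\gamma_{\rm b}^{\inf}/\gamma_{\rm e}^{\sup})$. *)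

theory Defs
  imports Complex_Main
begin

definition C_AWGN :: "real \<Rightarrow> real" where
  "C_AWGN \<gamma> = ln (1 + \<gamma>)"

definition gamma0 :: "real \<Rightarrow> real" where
  "gamma0 R = exp R - 1"

lemma C_AWGN_eq_iff_gamma0:
  assumes "\<gamma> > -1"
  shows "C_AWGN \<gamma> = R \<longleftrightarrow> \<gamma> = gamma0 R"
  using assms by (auto simp: C_AWGN_def gamma0_def)

text \<open>The Gallager function for the input distribution \<open>CN(0,1)\<close>. Bob's and Eve's functions are
  given by the same expression, on \<open>0 \<le> \<rho> \<le> 1\<close> and \<open>-1 < \<rho>' \<le> 0\<close> respectively.\<close>

definition E0 :: "real \<Rightarrow> real \<Rightarrow> real" where
  "E0 \<rho> \<gamma> = \<rho> * ln (1 + \<gamma> / (1 + \<rho>))"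

definition P_BER_b_U :: "nat \<Rightarrow> real \<Rightarrow> real \<Rightarrow> real" where
  "P_BER_b_U n R \<gamma>b =
     1 / 2 * (INF \<rho>\<in>{0..1}. exp (- (real n * (E0 \<rho> \<gamma>b - \<rho> * R))))"

text \<open>The maximum over the half-open interval is rendered as a supremum of values below 1.
  It is attained for every \<open>\<gamma>e > 0\<close>; for \<open>\<gamma>e = 0\<close> and \<open>R > 0\<close> it is only approached as
  \<open>\<rho>'\<close> tends to \<open>-1\<close>.\<close>

definition P_BER_e_L :: "nat \<Rightarrow> real \<Rightarrow> real \<Rightarrow> real \<Rightarrow> real" where
  "P_BER_e_L n \<beta> R \<gamma>e =
     \<beta> * (SUP \<rho>'\<in>{-1<..0}. 1 - exp (- (real n * (E0 \<rho>' \<gamma>e - \<rho>' * R))))"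

text \<open>\<open>Pb\<close> and \<open>Pe\<close> are block error probability thresholds; \<open>Pb / 2\<close> and \<open>\<beta> * Pe\<close> are the
  corresponding bit error rate thresholds.\<close>

definition feasible_b :: "nat \<Rightarrow> real \<Rightarrow> real \<Rightarrow> real set" where
  "feasible_b n R Pb = {\<gamma>b. gamma0 R < \<gamma>b \<and> P_BER_b_U n R \<gamma>b \<le> 1 / 2 * Pb}"

definition feasible_e :: "nat \<Rightarrow> real \<Rightarrow> real \<Rightarrow> real \<Rightarrow> real set" where
  "feasible_e n \<beta> R Pe = {\<gamma>e. 0 \<le> \<gamma>e \<and> \<gamma>e < gamma0 R \<and> P_BER_e_L n \<beta> R \<gamma>e \<ge> \<beta> * Pe}"

definition gamma_b_inf :: "nat \<Rightarrow> real \<Rightarrow> real \<Rightarrow> real" where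
  "gamma_b_inf n R Pb = Inf (feasible_b n R Pb)"

definition gamma_e_sup :: "nat \<Rightarrow> real \<Rightarrow> real \<Rightarrow> real \<Rightarrow> real" where
  "gamma_e_sup n \<beta> R Pe = Sup (feasible_e n \<beta> R Pe)"

definition security_gap :: "nat \<Rightarrow> real \<Rightarrow> real \<Rightarrow> real \<Rightarrow> real \<Rightarrow> real" where
  "security_gap n \<beta> R Pb Pe = 10 * log 10 (gamma_b_inf n R Pb / gamma_e_sup n \<beta> R Pe)"

text \<open>The common shape of Bob's objective (\<open>q = Pb\<close>) and Eve's objective (\<open>q = 1 - Pe\<close>).\<close>

definition snr_bound :: "nat \<Rightarrow> real \<Rightarrow> real \<Rightarrow> real \<Rightarrow> real" where
  "snr_bound n R q \<rho> = (1 + \<rho>) * (q powr (- (1 / (real n * \<rho>))) * exp R - 1)"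

end

theory Submission
  imports Defs
begin

text \<open>For fixed \<open>\<rho>\<close> the threshold condition on the error exponent is monotone in the SNR and can be
  solved for it: for \<open>\<rho> > 0\<close> it reads \<open>snr_bound \<rho> \<le> \<gamma>\<close> and for \<open>\<rho> < 0\<close> it reads
  \<open>\<gamma> \<le> snr_bound \<rho>\<close>. Since the optima over \<open>\<rho>\<close> are attained, the feasible SNRs are those beyond the
  best \<open>snr_bound \<rho>\<close>. On \<open>(-1, 0)\<close> the bound tends to \<open>0\<close> at \<open>-1\<close> and is negative near \<open>0\<close>, so it
  attains its maximum exactly if it takes a positive value somewhere.\<close>

section \<open>Solving the error exponent condition for the SNR at fixed \<rho>\<close>

lemma snr_bound_exp:
  assumes "0 < q"
  shows "snr_bound n R q \<rho> = (1 + \<rho>) * (exp (R - ln q / (real n * \<rho>)) - 1)"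
  using assms by (simp add: snr_bound_def powr_def exp_diff exp_minus field_simps)

lemma exp_le_one_plus_iff:
  fixes a \<gamma> s :: real
  assumes "0 < s" "0 \<le> \<gamma>"
  shows "s * (exp a - 1) \<le> \<gamma> \<longleftrightarrow> a \<le> ln (1 + \<gamma> / s)"
    and "\<gamma> \<le> s * (exp a - 1) \<longleftrightarrow> ln (1 + \<gamma> / s) \<le> a"
proof -
  have pos: "0 < 1 + \<gamma> / s" using assms by (simp add: add_pos_nonneg)
  have "s * (exp a - 1) \<le> \<gamma> \<longleftrightarrow> exp a \<le> 1 + \<gamma> / s"
    using assms by (simp add: field_simps)
  with pos show "s * (exp a - 1) \<le> \<gamma> \<longleftrightarrow> a \<le> ln (1 + \<gamma> / s)"
    by (simp add: ln_ge_iff)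
  have "\<gamma> \<le> s * (exp a - 1) \<longleftrightarrow> 1 + \<gamma> / s \<le> exp a"
    using assms by (simp add: field_simps)
  with pos show "\<gamma> \<le> s * (exp a - 1) \<longleftrightarrow> ln (1 + \<gamma> / s) \<le> a"
    by (metis exp_le_cancel_iff exp_ln)
qed

lemma exponent_le_iff_pos:
  assumes "n \<ge> 1" "0 < q" "0 < \<rho>" "0 \<le> \<gamma>"
  shows "exp (- (real n * (E0 \<rho> \<gamma> - \<rho> * R))) \<le> q \<longleftrightarrow> snr_bound n R q \<rho> \<le> \<gamma>"
proof -
  have "exp (- (real n * (E0 \<rho> \<gamma> - \<rho> * R))) \<le> q \<longleftrightarrow> - (real n * (E0 \<rho> \<gamma> - \<rho> * R)) \<le> ln q"
    using assms by (simp add: ln_ge_iff)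
  also have "\<dots> \<longleftrightarrow> R - ln q / (real n * \<rho>) \<le> ln (1 + \<gamma> / (1 + \<rho>))"
    using assms by (simp add: E0_def field_simps)
  also have "\<dots> \<longleftrightarrow> snr_bound n R q \<rho> \<le> \<gamma>"
    using assms by (simp add: snr_bound_exp exp_le_one_plus_iff)
  finally show ?thesis .
qed

text \<open>Isolating the logarithm means dividing by \<open>real n * \<rho>\<close>, which is
  negative here; this reverses the direction found for positive \<rho>.\<close>

lemma exponent_le_iff_neg:
  assumes "n \<ge> 1" "0 < q" "-1 < \<rho>" "\<rho> < 0" "0 \<le> \<gamma>"
  shows "exp (- (real n * (E0 \<rho> \<gamma> - \<rho> * R))) \<le> q \<longleftrightarrow> \<gamma> \<le> snr_bound n R q \<rho>"
proof -
  have neg: "real n * \<rho> < 0" using assms by (simp add: mult_pos_neg)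
  have "exp (- (real n * (E0 \<rho> \<gamma> - \<rho> * R))) \<le> q \<longleftrightarrow> - (real n * (E0 \<rho> \<gamma> - \<rho> * R)) \<le> ln q"
    using assms by (simp add: ln_ge_iff)
  also have "\<dots> \<longleftrightarrow> (R - ln (1 + \<gamma> / (1 + \<rho>))) * (real n * \<rho>) \<le> ln q"
    by (simp add: E0_def algebra_simps)
  also have "\<dots> \<longleftrightarrow> ln q / (real n * \<rho>) \<le> R - ln (1 + \<gamma> / (1 + \<rho>))"
    by (simp only: neg_divide_le_eq[OF neg])
  also have "\<dots> \<longleftrightarrow> ln (1 + \<gamma> / (1 + \<rho>)) \<le> R - ln q / (real n * \<rho>)"
    by linarith
  also have "\<dots> \<longleftrightarrow> \<gamma> \<le> snr_bound n R q \<rho>"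
    using assms by (simp add: snr_bound_exp exp_le_one_plus_iff)
  finally show ?thesis .
qed

lemma continuous_on_exponent:
  assumes "0 \<le> \<gamma>" "S \<subseteq> {-1<..}"
  shows "continuous_on S (\<lambda>\<rho>. exp (- (real n * (E0 \<rho> \<gamma> - \<rho> * R))))"
proof -
  have "1 + \<rho> \<noteq> 0" "1 + \<gamma> / (1 + \<rho>) > 0" if "\<rho> \<in> S" for \<rho>
  proof -
    have "0 < 1 + \<rho>" using that assms by force
    then show "1 + \<rho> \<noteq> 0" "1 + \<gamma> / (1 + \<rho>) > 0"
      using assms by (simp_all add: add_pos_nonneg)
  qed
  then show ?thesis
    unfolding E0_def by (intro continuous_intros) (auto simp: less_le)
qed

lemma continuous_on_snr_bound:
  assumes "n \<ge> 1" "0 < q" "0 \<notin> S"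
  shows "continuous_on S (snr_bound n R q)"
proof -
  have "continuous_on S (\<lambda>\<rho>. (1 + \<rho>) * (exp (R - ln q / (real n * \<rho>)) - 1))"
    using assms by (intro continuous_intros) auto
  then show ?thesis
    using assms by (simp add: snr_bound_exp cong: continuous_on_cong)
qed

section \<open>Bob's SNR infimum\<close>

text \<open>Since \<open>ln q < 0\<close>, the exponent exceeds \<open>R\<close>, and the factor
  \<open>1 + \<rho>\<close> only enlarges the value. Hence Bob's constraint
  \<open>gamma0 R < \<gamma>\<close> holds automatically above any \<open>snr_bound\<close>.\<close>

lemma gamma0_less_snr_bound_pos:
  assumes "n \<ge> 1" "R \<ge> 0" "0 < q" "q < 1" "0 < \<rho>"
  shows "gamma0 R < snr_bound n R q \<rho>"
proof -
  have "ln q / (real n * \<rho>) < 0"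
    using assms by (simp add: divide_neg_pos)
  then have "exp R < exp (R - ln q / (real n * \<rho>))" by simp
  then have "exp R - 1 < 1 * (exp (R - ln q / (real n * \<rho>)) - 1)" by simp
  also have "\<dots> \<le> (1 + \<rho>) * (exp (R - ln q / (real n * \<rho>)) - 1)"
    using assms \<open>ln q / (real n * \<rho>) < 0\<close> by (intro mult_right_mono) auto
  finally show ?thesis using assms by (simp add: gamma0_def snr_bound_exp)
qed

text \<open>The interval is open at 0, but the objective blows up there, so a minimum over a compact
  \<open>{\<delta>..1}\<close> is global.\<close>

lemma snr_bound_attains_min:
  assumes "n \<ge> 1" "R \<ge> 0" "0 < q" "q < 1"
  shows "\<exists>\<rho>. is_arg_min (snr_bound n R q) (\<lambda>x. 0 < x \<and> x \<le> 1) \<rho>"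
proof -
  define M where "M = snr_bound n R q 1"
  have lnq: "ln q < 0" using assms by simp
  have "0 \<le> gamma0 R" using assms by (simp add: gamma0_def)
  then have M: "0 < M"
    using gamma0_less_snr_bound_pos[of n R q 1] assms by (simp add: M_def)
  \<comment> \<open>Chosen so that \<open>- ln q / (real n * y) > M\<close> for
    \<open>y < \<delta>\<close>; with \<open>exp t - 1 \<ge> t\<close> this puts the objective above
    its value \<open>M\<close> at 1. The cap keeps 1 in the compact interval.\<close>
  define \<delta> where "\<delta> = min 1 (- ln q / (real n * M))"
  have "0 < - ln q / (real n * M)" using lnq M assms by (intro divide_pos_pos) auto
  then have \<delta>: "0 < \<delta>" "\<delta> \<le> 1" by (auto simp: \<delta>_def)
  have "continuous_on {\<delta>..1} (snr_bound n R q)"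
    using assms \<delta> by (intro continuous_on_snr_bound) auto
  then obtain x where x: "x \<in> {\<delta>..1}" "\<And>y. y \<in> {\<delta>..1} \<Longrightarrow> snr_bound n R q x \<le> snr_bound n R q y"
    using continuous_attains_inf[of "{\<delta>..1}" "snr_bound n R q"] \<delta> by auto
  have near0: "M < snr_bound n R q y" if "0 < y" "y < \<delta>" for y
  proof -
    have "y < - ln q / (real n * M)" using that by (simp add: \<delta>_def)
    then have "M < - ln q / (real n * y)"
      using that M assms by (simp add: field_simps)
    also have "\<dots> \<le> R - ln q / (real n * y)" using assms by simp
    also have "\<dots> \<le> exp (R - ln q / (real n * y)) - 1"
      using exp_ge_add_one_self[of "R - ln q / (real n * y)"] by linarith
    also have "\<dots> \<le> (1 + y) * (exp (R - ln q / (real n * y)) - 1)"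
    proof -
      have "ln q / (real n * y) \<le> 0"
        using lnq that by (intro divide_nonpos_nonneg) auto
      then have "0 \<le> R - ln q / (real n * y)" using assms by linarith
      then show ?thesis using that by (simp add: mult_le_cancel_right1)
    qed
    finally show ?thesis using assms by (simp add: snr_bound_exp)
  qed
  have "snr_bound n R q x \<le> snr_bound n R q y" if "0 < y" "y \<le> 1" for y
  proof (cases "y < \<delta>")
    case True
    then show ?thesis using near0[of y] x(2)[of 1] that \<delta> by (auto simp: M_def)
  next
    case False
    then show ?thesis using x(2) that by auto
  qed
  then have "is_arg_min (snr_bound n R q) (\<lambda>x. 0 < x \<and> x \<le> 1) x"
    using x \<delta> by (auto simp: is_arg_min_linorder)
  then show ?thesis by blast
qed

lemma feasible_b_eq:
  assumes "n \<ge> 1" "R \<ge> 0" "0 < Pb" "Pb < 1"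
  shows "feasible_b n R Pb = {\<gamma>. \<exists>\<rho>. 0 < \<rho> \<and> \<rho> \<le> 1 \<and> snr_bound n R Pb \<rho> \<le> \<gamma>}"
proof -
  have "gamma0 R < \<gamma> \<and> P_BER_b_U n R \<gamma> \<le> 1 / 2 * Pb \<longleftrightarrow>
      (\<exists>\<rho>. 0 < \<rho> \<and> \<rho> \<le> 1 \<and> snr_bound n R Pb \<rho> \<le> \<gamma>)" (is "?L \<longleftrightarrow> ?R") for \<gamma>
  proof -
    let ?g = "\<lambda>\<rho>. exp (- (real n * (E0 \<rho> \<gamma> - \<rho> * R)))"
    have g0: "0 \<le> gamma0 R" using assms by (simp add: gamma0_def)
    show ?thesis
    proof
      assume L: ?L
      then have \<gamma>: "0 \<le> \<gamma>" using g0 by simp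
      have "continuous_on {0..1} ?g" using \<gamma> by (intro continuous_on_exponent) auto
      then obtain x where x: "x \<in> {0..1}" "\<And>y. y \<in> {0..1} \<Longrightarrow> ?g x \<le> ?g y"
        using continuous_attains_inf[of "{0..1}" ?g] by auto
      have "?g x \<le> (INF \<rho>\<in>{0..1}. ?g \<rho>)"
        using x by (intro cINF_greatest) auto
      then have le: "?g x \<le> Pb" using L by (simp add: P_BER_b_U_def)
      \<comment> \<open>At 0 the exponent vanishes, so \<open>?g 0 = 1 > Pb\<close>.\<close>
      then have "x \<noteq> 0" using assms by (auto simp: E0_def)
      then have "0 < x" "x \<le> 1" using x by auto
      then show ?R using le \<gamma> assms by (auto simp: exponent_le_iff_pos)
    next
      assume ?R
      then obtain \<rho> where \<rho>: "0 < \<rho>" "\<rho> \<le> 1" "snr_bound n R Pb \<rho> \<le> \<gamma>" by blast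
      then have \<gamma>: "gamma0 R < \<gamma>"
        using gamma0_less_snr_bound_pos[of n R Pb \<rho>] assms by simp
      have "(INF \<rho>\<in>{0..1}. ?g \<rho>) \<le> ?g \<rho>"
        using \<rho> by (intro cINF_lower bdd_belowI2[where m = 0]) auto
      also have "\<dots> \<le> Pb" using \<rho> \<gamma> g0 assms by (simp add: exponent_le_iff_pos)
      finally show ?L using \<gamma> by (simp add: P_BER_b_U_def)
    qed
  qed
  then show ?thesis by (simp add: feasible_b_def)
qed

lemma gamma_b_inf_eq:
  assumes "n \<ge> 1" "R \<ge> 0" "0 < Pb" "Pb < 1"
    and "is_arg_min (snr_bound n R Pb) (\<lambda>x. 0 < x \<and> x \<le> 1) \<rho>"
  shows "gamma_b_inf n R Pb = snr_bound n R Pb \<rho>"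
proof -
  have "{\<gamma>. \<exists>\<rho>. 0 < \<rho> \<and> \<rho> \<le> 1 \<and> snr_bound n R Pb \<rho> \<le> \<gamma>} = {snr_bound n R Pb \<rho>..}"
    using assms(5) by (auto simp: is_arg_min_linorder intro: order.trans)
  then show ?thesis using assms by (simp add: gamma_b_inf_def feasible_b_eq)
qed

section \<open>Eve's SNR supremum\<close>

text \<open>With q below 1 and \<rho> negative, \<open>ln q / (real n * \<rho>)\<close> is positive
  and pulls the exponent below \<open>R\<close>. The bound forces decay to at most 0 at -1, and also
  yields Eve's constraint \<open>\<gamma> < gamma0 R\<close>.\<close>

lemma snr_bound_neg_upper:
  assumes "n \<ge> 1" "0 < q" "q < 1" "-1 < \<rho>" "\<rho> < 0"
  shows "snr_bound n R q \<rho> < (1 + \<rho>) * gamma0 R"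
proof -
  have "0 < ln q / (real n * \<rho>)"
    using assms by (simp add: divide_neg_neg mult_pos_neg)
  then show ?thesis using assms by (simp add: snr_bound_exp gamma0_def)
qed

lemma snr_bound_neg_less_gamma0:
  assumes "n \<ge> 1" "0 < q" "q < 1" "-1 < \<rho>" "\<rho> < 0" "0 < snr_bound n R q \<rho>"
  shows "snr_bound n R q \<rho> < gamma0 R"
proof -
  note less = snr_bound_neg_upper[OF assms(1-5), of R]
  with assms have "0 < (1 + \<rho>) * gamma0 R" by linarith
  then have "0 < gamma0 R" using assms by (simp add: zero_less_mult_iff)
  then have "(1 + \<rho>) * gamma0 R \<le> 1 * gamma0 R"
    using assms by (intro mult_right_mono) auto
  with less show ?thesis by simp
qed

text \<open>The superlevel set of the positive value at \<open>r\<close> lies in a compact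
  subinterval of (-1, 0), where continuity gives a maximum.\<close>

lemma snr_bound_attains_max:
  assumes "n \<ge> 1" "R \<ge> 0" "0 < q" "q < 1"
    and r: "-1 < r" "r < 0" "0 < snr_bound n R q r"
  shows "\<exists>\<rho>. is_arg_max (snr_bound n R q) (\<lambda>x. -1 < x \<and> x < 0) \<rho>"
proof -
  let ?f = "snr_bound n R q"
  have g0: "0 < gamma0 R"
    using snr_bound_neg_less_gamma0[OF assms(1,3,4) r] r by simp
  \<comment> \<open>\<open>a\<close> solves \<open>(1 + a) * gamma0 R = ?f r\<close>: further left,
    the upper bound \<open>(1 + y) * gamma0 R\<close> is already below \<open>?f r\<close>.\<close>
  define a where "a = ?f r / gamma0 R - 1"
  \<comment> \<open>A positive value at \<open>y\<close> needs
    \<open>ln q / (real n * y) < R\<close>. Weakening \<open>R\<close> to \<open>R + 1\<close> gives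
    a denominator that is positive directly from \<open>R \<ge> 0\<close>.\<close>
  define b where "b = ln q / (real n * (R + 1))"
  have a: "-1 < a" using r g0 by (simp add: a_def)
  have b: "b < 0" using assms by (simp add: b_def divide_neg_pos)
  have outer: "a \<le> y \<and> y \<le> b" if y: "-1 < y" "y < 0" and fy: "?f r \<le> ?f y" for y
  proof
    have "?f r \<le> (1 + y) * gamma0 R"
      using snr_bound_neg_upper[OF assms(1,3,4) y, of R] fy by linarith
    then show "a \<le> y" using g0 by (simp add: a_def field_simps)
    have "0 < (1 + y) * (exp (R - ln q / (real n * y)) - 1)"
      using r fy assms by (simp add: snr_bound_exp)
    then have "ln q / (real n * y) \<le> R + 1"
      using y by (simp add: zero_less_mult_iff)
    moreover have "real n * y < 0" using y assms by (simp add: mult_pos_neg)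
    ultimately have "(R + 1) * (real n * y) \<le> ln q"
      by (simp only: neg_divide_le_eq)
    moreover have "0 < real n * (R + 1)" using assms by simp
    ultimately show "y \<le> b"
      by (simp add: b_def pos_le_divide_eq mult_ac)
  qed
  have "r \<in> {a..b}" using outer[of r] r by simp
  moreover have "continuous_on {a..b} ?f"
    using assms b by (intro continuous_on_snr_bound) auto
  ultimately obtain x where x: "x \<in> {a..b}" "\<And>y. y \<in> {a..b} \<Longrightarrow> ?f y \<le> ?f x"
    using continuous_attains_sup[of "{a..b}" ?f] by auto
  have "?f y \<le> ?f x" if "-1 < y" "y < 0" for y
    using outer[of y] that x(2)[of y] x(2)[OF \<open>r \<in> {a..b}\<close>] by fastforce
  then have "is_arg_max ?f (\<lambda>x. -1 < x \<and> x < 0) x"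
    using x a b by (auto simp: is_arg_max_linorder)
  then show ?thesis by blast
qed

text \<open>A negative maximum is beaten near -1, where the function tends to 0. A zero maximum is
  beaten by moving left, which strictly raises the exponent above 0.\<close>

lemma snr_bound_max_pos:
  assumes "n \<ge> 1" "0 < q" "q < 1"
    and max: "is_arg_max (snr_bound n R q) (\<lambda>x. -1 < x \<and> x < 0) \<rho>"
  shows "0 < snr_bound n R q \<rho>"
proof (rule ccontr)
  let ?f = "snr_bound n R q"
  have \<rho>: "-1 < \<rho>" "\<rho> < 0" and le: "\<And>y. -1 < y \<Longrightarrow> y < 0 \<Longrightarrow> ?f y \<le> ?f \<rho>"
    using max by (auto simp: is_arg_max_linorder)
  assume "\<not> 0 < ?f \<rho>"
  then consider "?f \<rho> < 0" | "?f \<rho> = 0" by linarith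
  then show False
  proof cases
    case 1
    \<comment> \<open>The value at \<open>y\<close> exceeds \<open>- (1 + y)\<close>, so
      \<open>1 + y \<le> - ?f \<rho>\<close> suffices; the cap 1/2 keeps \<open>y\<close>
      negative.\<close>
    define y where "y = min (- ?f \<rho>) (1 / 2) - 1"
    have y: "-1 < y" "y < 0" "1 + y \<le> - ?f \<rho>" using 1 by (auto simp: y_def)
    have "(1 + y) * (0 - 1) < (1 + y) * (exp (R - ln q / (real n * y)) - 1)"
      using y by (intro mult_strict_left_mono) auto
    then have "?f \<rho> < ?f y" using y assms by (simp add: snr_bound_exp)
    then show False using le[of y] y by simp
  next
    case 2
    define y where "y = (\<rho> - 1) / 2"
    have y: "-1 < y" "y < \<rho>" using \<rho> by (auto simp: y_def)
    have "R - ln q / (real n * \<rho>) = 0" using 2 \<rho> assms by (simp add: snr_bound_exp)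
    moreover have "ln q / (real n * y) < ln q / (real n * \<rho>)"
    proof -
      have "real n * y < real n * \<rho>" "real n * \<rho> < 0" "real n * y < 0"
        using y \<rho> assms by (auto simp: mult_pos_neg)
      then show ?thesis
        using assms by (intro divide_strict_left_mono_neg mult_neg_neg) auto
    qed
    ultimately have "0 < ?f y" using y assms by (simp add: snr_bound_exp)
    then show False using le[of y] y \<rho> 2 by simp
  qed
qed

text \<open>Restricted to \<open>\<gamma> > 0\<close>: at \<open>\<gamma> = 0\<close> the supremum over \<open>\<rho>'\<close> need not be attained.\<close>

lemma feasible_e_iff:
  assumes "n \<ge> 1" "\<beta> > 0" "0 < Pe" "Pe < 1" "0 < \<gamma>"
  shows "\<gamma> \<in> feasible_e n \<beta> R Pe \<longleftrightarrow>
    (\<exists>\<rho>. -1 < \<rho> \<and> \<rho> < 0 \<and> \<gamma> \<le> snr_bound n R (1 - Pe) \<rho>)" (is "?L \<longleftrightarrow> ?R")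
proof -
  let ?g = "\<lambda>\<rho>. 1 - exp (- (real n * (E0 \<rho> \<gamma> - \<rho> * R)))"
  have iff: "Pe \<le> ?g \<rho> \<longleftrightarrow> \<gamma> \<le> snr_bound n R (1 - Pe) \<rho>" if "-1 < \<rho>" "\<rho> < 0" for \<rho>
    using exponent_le_iff_neg[of n "1 - Pe" \<rho> \<gamma> R] that assms by (simp add: algebra_simps)
  show ?thesis
  proof
    assume L: ?L
    then have \<gamma>: "\<gamma> < gamma0 R" and "\<beta> * Pe \<le> \<beta> * (SUP \<rho>\<in>{-1<..0}. ?g \<rho>)"
      by (auto simp: feasible_e_def P_BER_e_L_def)
    then have Sup: "Pe \<le> (SUP \<rho>\<in>{-1<..0}. ?g \<rho>)" using assms by simp
    \<comment> \<open>For \<open>y < a\<close> one has \<open>(1 + y) * gamma0 R < \<gamma>\<close>,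
      which makes \<open>?g y \<le> 0 = ?g 0\<close>. So the supremum is governed by the compact
      \<open>{a..0}\<close> and attained; \<gamma> > 0 is what gives \<open>-1 < a\<close>.\<close>
    define a where "a = \<gamma> / gamma0 R - 1"
    have a: "-1 < a" "a < 0" using \<gamma> assms by (auto simp: a_def)
    have "continuous_on {a..0} ?g"
      using a assms by (intro continuous_on_diff continuous_on_const continuous_on_exponent) auto
    then obtain x where x: "x \<in> {a..0}" "\<And>y. y \<in> {a..0} \<Longrightarrow> ?g y \<le> ?g x"
      using continuous_attains_sup[of "{a..0}" ?g] a by auto
    have x0: "0 \<le> ?g x" using x(2)[of 0] a by (simp add: E0_def)
    have "?g y \<le> 0" if y: "-1 < y" "y < a" for y
    proof -
      have "1 + y \<le> \<gamma> / gamma0 R" using y by (simp add: a_def)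
      then have "(1 + y) * (exp R - 1) \<le> \<gamma>"
        using \<gamma> assms by (simp only: gamma0_def pos_le_divide_eq[OF order.strict_trans])
      then have "R \<le> ln (1 + \<gamma> / (1 + y))"
        using exp_le_one_plus_iff(1)[of "1 + y" \<gamma> R] y assms by simp
      then have "y * ln (1 + \<gamma> / (1 + y)) \<le> y * R"
        using y a by (intro mult_left_mono_neg) auto
      then have "real n * (E0 y \<gamma> - y * R) \<le> 0"
        by (simp add: E0_def mult_nonneg_nonpos)
      then show ?thesis by simp
    qed
    then have "?g y \<le> ?g x" if "y \<in> {-1<..0}" for y
      using x(2)[of y] x0 that by fastforce
    then have "(SUP \<rho>\<in>{-1<..0}. ?g \<rho>) \<le> ?g x"
      by (intro cSUP_least) auto
    then have le: "Pe \<le> ?g x" using Sup by linarith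
    \<comment> \<open>The value at 0 is 0, below \<open>Pe\<close>.\<close>
    then have "x \<noteq> 0" using assms by (auto simp: E0_def)
    then have "-1 < x" "x < 0" using x a by auto
    then show ?R using le iff[of x] by blast
  next
    assume ?R
    then obtain \<rho> where \<rho>: "-1 < \<rho>" "\<rho> < 0" "\<gamma> \<le> snr_bound n R (1 - Pe) \<rho>" by blast
    have "\<gamma> < gamma0 R"
      using snr_bound_neg_less_gamma0[of n "1 - Pe" \<rho> R] \<rho> assms by simp
    moreover have "Pe \<le> ?g \<rho>" using \<rho> iff by simp
    moreover have "?g \<rho> \<le> (SUP \<rho>\<in>{-1<..0}. ?g \<rho>)"
      using \<rho> by (intro cSUP_upper bdd_aboveI2[where M = 1]) auto
    ultimately show ?L
      using assms by (auto simp: feasible_e_def P_BER_e_L_def)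
  qed
qed

lemma arg_max_is_max_feasible_e:
  assumes "n \<ge> 1" "\<beta> > 0" "0 < Pe" "Pe < 1"
    and "is_arg_max (snr_bound n R (1 - Pe)) (\<lambda>x. -1 < x \<and> x < 0) \<rho>"
  shows "snr_bound n R (1 - Pe) \<rho> \<in> feasible_e n \<beta> R Pe"
    and "gamma_e_sup n \<beta> R Pe = snr_bound n R (1 - Pe) \<rho>"
proof -
  let ?f = "snr_bound n R (1 - Pe)"
  have pos: "0 < ?f \<rho>" using assms by (intro snr_bound_max_pos) auto
  show mem: "?f \<rho> \<in> feasible_e n \<beta> R Pe"
    using feasible_e_iff[OF assms(1-4) pos] assms(5) by (auto simp: is_arg_max_linorder)
  have "\<gamma> \<le> ?f \<rho>" if "\<gamma> \<in> feasible_e n \<beta> R Pe" for \<gamma>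
  \<comment> \<open>The characterisation covers positive SNRs only; a feasible \<gamma> = 0 lies
    below the maximum because that is positive.\<close>
  proof (cases "0 < \<gamma>")
    case True
    with that obtain r where "-1 < r" "r < 0" "\<gamma> \<le> ?f r"
      using feasible_e_iff[OF assms(1-4)] by blast
    moreover from this have "?f r \<le> ?f \<rho>"
      using assms(5) by (auto simp: is_arg_max_linorder)
    ultimately show ?thesis by linarith
  qed (use pos in linarith)
  then show "gamma_e_sup n \<beta> R Pe = ?f \<rho>"
    unfolding gamma_e_sup_def using mem by (intro cSup_eq_maximum) auto
qed

text \<open>Either side amounts to \<open>snr_bound\<close> being positive somewhere on (-1, 0),
  that is, to \<open>real n * R > - ln (1 - Pe)\<close>. In case of equality the feasible set is
  \<open>{0}\<close>; below it the set is empty, and its \<open>Sup\<close> carries no information,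
  hence the separate nonemptiness conjunct.\<close>

lemma arg_max_exists_iff:
  assumes "n \<ge> 1" "R \<ge> 0" "\<beta> > 0" "0 < Pe" "Pe < 1"
  shows "(\<exists>\<rho>. is_arg_max (snr_bound n R (1 - Pe)) (\<lambda>x. -1 < x \<and> x < 0) \<rho>)
    \<longleftrightarrow> feasible_e n \<beta> R Pe \<noteq> {} \<and> gamma_e_sup n \<beta> R Pe > 0" (is "?L \<longleftrightarrow> ?R")
proof
  assume ?L
  then obtain \<rho> where \<rho>: "is_arg_max (snr_bound n R (1 - Pe)) (\<lambda>x. -1 < x \<and> x < 0) \<rho>" by blast
  then have "0 < snr_bound n R (1 - Pe) \<rho>" using assms by (intro snr_bound_max_pos) auto
  then show ?R using arg_max_is_max_feasible_e[OF assms(1,3-5) \<rho>] by auto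
next
  assume R: ?R
  then obtain \<gamma> where \<gamma>: "\<gamma> \<in> feasible_e n \<beta> R Pe" "0 < \<gamma>"
    unfolding gamma_e_sup_def by (meson less_cSupE)
  then obtain r where r: "-1 < r" "r < 0" "\<gamma> \<le> snr_bound n R (1 - Pe) r"
    using feasible_e_iff[OF assms(1,3-5)] by blast
  with \<gamma> show ?L
    using assms by (intro snr_bound_attains_max[where r = r]) auto
qed

text \<open>Quantifying over all optimisers makes the formula independent of which one is picked.
  Existence is asserted separately: Bob's optimiser always exists, Eve's exactly when the quotient
  in the gap has a genuine positive denominator.\<close>

theorem theorem2:
  fixes n :: nat and \<beta> R Pb Pe :: real
  assumes "n \<ge> 1" and "R \<ge> 0" and "\<beta> > 0"
    and "0 < Pb" and "Pb < 1" and "0 < Pe" and "Pe < 1"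
  shows "(\<forall>\<rho> \<rho>'. is_arg_min (snr_bound n R Pb) (\<lambda>x. 0 < x \<and> x \<le> 1) \<rho> \<longrightarrow>
            is_arg_max (snr_bound n R (1 - Pe)) (\<lambda>x. -1 < x \<and> x < 0) \<rho>' \<longrightarrow>
            security_gap n \<beta> R Pb Pe =
              10 * log 10
                (((1 + \<rho>) * (Pb powr (- (1 / (real n * \<rho>))) * exp R - 1)) /
                 ((1 + \<rho>') * ((1 - Pe) powr (- (1 / (real n * \<rho>'))) * exp R - 1))))
       \<and> (\<exists>\<rho>. is_arg_min (snr_bound n R Pb) (\<lambda>x. 0 < x \<and> x \<le> 1) \<rho>)
       \<and> ((\<exists>\<rho>'. is_arg_max (snr_bound n R (1 - Pe)) (\<lambda>x. -1 < x \<and> x < 0) \<rho>')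
            \<longleftrightarrow> feasible_e n \<beta> R Pe \<noteq> {} \<and> gamma_e_sup n \<beta> R Pe > 0)"
  using gamma_b_inf_eq[OF assms(1,2,4,5)] arg_max_is_max_feasible_e(2)[OF assms(1,3,6,7)]
    snr_bound_attains_min[OF assms(1,2,4,5)] arg_max_exists_iff[OF assms(1-3,6,7)]
  by (simp add: security_gap_def snr_bound_def[symmetric])

end
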